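(* Let $\mathcal{I}$, $\mathcal{K}$ be ideals on a set $S$. If $(X,\Phi)$ is a complete uniform space, then any $\mathcal{I}^{\mathcal{K}}$-Cauchy function $f\colon S\to X$ is $\mathcal{I}^{\mathcal{K}}$-convergent (to some point of $X$).
   Context: An ideal on a set $S$ is a nonempty family of subsets of $S$ closed under subsets and finite unions (not required to be proper). Its dual filter is $\mathcal{F}(\mathcal{I})=\{S\setminus A: A\in\mathcal{I}\}$. For $M\subseteq S$, $\mathcal{K}|_M=\{A\cap M: A\in\mathcal{K}\}$ is the trace ideal on $M$. Uniform spaces $(X,\Phi)$ are assumed Hausdorff ($\bigcap\Phi$ is the diagonal) and entourages $U\in\Phi$ are taken symmetric. $(X,\Phi)$ is complete if every Cauchy net (equivalently, every Cauchy filter) in $X$ converges. A map $f\colon S\to X$ is $\mathcal{I}$-Cauchy if for every $U\in\Phi$ there exists $m\in S$ such that $\{n\in S: (f(n),f(m))\notin U\}\in\mathcal{I}$. It is $\mathcal{I}^{\mathcal{K}}$-Cauchy if there is $M\in\mathcal{F}(\mathcal{I})$ such that $f|_M\colon M\to X$ is $\mathcal{K}|_M$-Cauchy. A map $f\colon S\to X$ into a topological space is $\mathcal{I}$-convergent to $x\in X$ if $f^{-1}(U)\in\mathcal{F}(\mathcal{I})$ for each neighborhood $U$ of $x$. It is $\mathcal{I}^{\mathcal{K}}$-convergent to $x$ if there is $M\in\mathcal{F}(\mathcal{I})$ such that the function $g\colon S\to X$ with $g(s)=f(s)$ for $s\in M$ and $g(s)=x$ for $s\notin M$ is $\mathcal{K}$-convergent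 to $x$ (equivalently, $f|_M$ is $\mathcal{K}|_M$-convergent to $x$). *)

theory Defs
  imports Complex_Main
begin

section \<open>Ideals on a set\<close>

text \<open>Ideals are not required to be proper.\<close>

definition ideal_on :: "'s set \<Rightarrow> 's set set \<Rightarrow> bool" where
  "ideal_on S \<I> \<longleftrightarrow>
     \<I> \<subseteq> Pow S \<and> \<I> \<noteq> {} \<and>
     (\<forall>A\<in>\<I>. \<forall>B\<subseteq>A. B \<in> \<I>) \<and>
     (\<forall>A\<in>\<I>. \<forall>B\<in>\<I>. A \<union> B \<in> \<I>)"

definition dual_filter :: "'s set \<Rightarrow> 's set set \<Rightarrow> 's set set" where
  "dual_filter S \<I> = {S - A | A. A \<in> \<I>}"

definition trace_ideal :: "'s set set \<Rightarrow> 's set \<Rightarrow> 's set set" where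
  "trace_ideal \<K> M = {A \<inter> M | A. A \<in> \<K>}"


section \<open>Entourages\<close>

text \<open>Entourages are taken to be symmetric. The two lemmas below show that this convention is
  harmless, and that the class \<^class>\<open>t2_space\<close> expresses the usual separation condition on the
  uniformity.\<close>

definition entourages :: "('a::uniform_space \<times> 'a) set set" where
  "entourages = {U. eventually (\<lambda>p. p \<in> U) uniformity \<and> sym U}"

lemma entourage_symmetric_core:
  fixes V :: "('a::uniform_space \<times> 'a) set"
  assumes "eventually (\<lambda>p. p \<in> V) uniformity"
  shows "V \<inter> V\<inverse> \<in> entourages"
proof -
  have "eventually (\<lambda>p. p \<in> V\<inverse>) uniformity"
    using uniformity_sym[OF assms] by (simp add: case_prod_beta' converse_unfold)
  with assms have "eventually (\<lambda>p. p \<in> V \<inter> V\<inverse>) uniformity"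
    by (auto intro: eventually_elim2)
  moreover have "sym (V \<inter> V\<inverse>)"
    by (auto simp: sym_def)
  ultimately show ?thesis
    by (simp add: entourages_def)
qed

lemma Inter_entourages_eq_Id_iff_hausdorff:
  "\<Inter> (entourages :: ('a::uniform_space \<times> 'a) set set) = Id \<longleftrightarrow>
     (\<forall>x y :: 'a. x \<noteq> y \<longrightarrow> (\<exists>U V. open U \<and> open V \<and> x \<in> U \<and> y \<in> V \<and> U \<inter> V = {}))"
  (is "?L \<longleftrightarrow> ?R")
proof
  assume L: ?L
  show ?R
  proof (intro allI impI)
    fix x y :: 'a
    assume "x \<noteq> y"
    then have "(x, y) \<notin> \<Inter> entourages"
      unfolding L by simp
    then obtain E where E: "E \<in> entourages" "(x, y) \<notin> E"
      by blast
    then have "eventually (\<lambda>p. p \<in> E) uniformity"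
      by (simp add: entourages_def)
    then obtain D where D: "eventually D uniformity"
      and DE: "\<And>x y z. D (x, y) \<Longrightarrow> D (y, z) \<Longrightarrow> (x, z) \<in> E"
      by (rule uniformity_transE) (rule that)
    have "eventually (\<lambda>z. D (x, z)) (nhds x)"
      unfolding eventually_nhds_uniformity by (rule eventually_mono[OF D]) auto
    then obtain U where U: "open U" "x \<in> U" "\<And>z. z \<in> U \<Longrightarrow> D (x, z)"
      unfolding eventually_nhds by blast
    have "eventually (\<lambda>z. D (z, y)) (nhds y)"
      unfolding eventually_nhds_uniformity
      by (rule eventually_mono[OF uniformity_sym[OF D]]) auto
    then obtain V where V: "open V" "y \<in> V" "\<And>z. z \<in> V \<Longrightarrow> D (z, y)"
      unfolding eventually_nhds by blast
    have "U \<inter> V = {}"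
      using U(3) V(3) DE E(2) by blast
    with U V show "\<exists>U V. open U \<and> open V \<and> x \<in> U \<and> y \<in> V \<and> U \<inter> V = {}"
      by blast
  qed
next
  assume R: ?R
  show ?L
  proof (intro equalityI subsetI)
    fix p :: "'a \<times> 'a"
    assume p: "p \<in> \<Inter> entourages"
    obtain x y where xy: "p = (x, y)" by (cases p)
    show "p \<in> Id"
    proof (rule ccontr)
      assume "p \<notin> Id"
      with xy have "x \<noteq> y" by simp
      with R obtain U where U: "open U" "x \<in> U" "y \<notin> U"
        by blast
      let ?V = "{q. fst q = x \<longrightarrow> snd q \<in> U}"
      have "eventually (\<lambda>q. q \<in> ?V) uniformity"
        using U(1)[unfolded open_uniformity, rule_format, OF U(2)]
        by (simp add: case_prod_beta')
      then have "?V \<inter> ?V\<inverse> \<in> entourages"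
        by (rule entourage_symmetric_core)
      with p have "(x, y) \<in> ?V \<inter> ?V\<inverse>"
        unfolding xy by (rule InterD)
      with U(3) show False by simp
    qed
  next
    fix p :: "'a \<times> 'a"
    assume "p \<in> Id"
    then show "p \<in> \<Inter> entourages"
      by (cases p) (auto simp: entourages_def dest!: uniformity_refl)
  qed
qed


section \<open>Cauchy functions and convergence along ideals\<close>

text \<open>A map from \<open>S\<close> to \<open>X\<close> is a total function of which only the values on \<open>S\<close> matter;
  restricting it to \<open>M \<subseteq> S\<close> amounts to replacing \<open>S\<close> by \<open>M\<close> below.\<close>

definition I_Cauchy :: "'s set \<Rightarrow> 's set set \<Rightarrow> ('s \<Rightarrow> 'a::uniform_space) \<Rightarrow> bool" where
  "I_Cauchy S \<I> f \<longleftrightarrow>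
     (\<forall>U\<in>entourages. \<exists>m\<in>S. {n \<in> S. (f n, f m) \<notin> U} \<in> \<I>)"

definition IK_Cauchy ::
    "'s set \<Rightarrow> 's set set \<Rightarrow> 's set set \<Rightarrow> ('s \<Rightarrow> 'a::uniform_space) \<Rightarrow> bool" where
  "IK_Cauchy S \<I> \<K> f \<longleftrightarrow>
     (\<exists>M\<in>dual_filter S \<I>. I_Cauchy M (trace_ideal \<K> M) f)"

lemma I_Cauchy_iff_all_entourages:
  assumes "ideal_on S \<I>"
  shows "I_Cauchy S \<I> f \<longleftrightarrow>
    (\<forall>U. eventually (\<lambda>p. p \<in> U) uniformity \<longrightarrow> (\<exists>m\<in>S. {n \<in> S. (f n, f m) \<notin> U} \<in> \<I>))"
proof
  assume C: "I_Cauchy S \<I> f"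
  show "\<forall>U. eventually (\<lambda>p. p \<in> U) uniformity \<longrightarrow> (\<exists>m\<in>S. {n \<in> S. (f n, f m) \<notin> U} \<in> \<I>)"
  proof (intro allI impI)
    fix U :: "('b \<times> 'b) set"
    assume "eventually (\<lambda>p. p \<in> U) uniformity"
    from C entourage_symmetric_core[OF this]
    obtain m where m: "m \<in> S" "{n \<in> S. (f n, f m) \<notin> U \<inter> U\<inverse>} \<in> \<I>"
      unfolding I_Cauchy_def by blast
    have "{n \<in> S. (f n, f m) \<notin> U} \<subseteq> {n \<in> S. (f n, f m) \<notin> U \<inter> U\<inverse>}"
      by blast
    moreover have "\<forall>A\<in>\<I>. \<forall>B\<subseteq>A. B \<in> \<I>"
      using assms by (simp add: ideal_on_def)
    ultimately have "{n \<in> S. (f n, f m) \<notin> U} \<in> \<I>"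
      using m(2) by simp
    with m(1) show "\<exists>m\<in>S. {n \<in> S. (f n, f m) \<notin> U} \<in> \<I>" ..
  qed
qed (simp add: I_Cauchy_def entourages_def)

definition I_convergent_to ::
    "'s set \<Rightarrow> 's set set \<Rightarrow> ('s \<Rightarrow> 'a::topological_space) \<Rightarrow> 'a \<Rightarrow> bool" where
  "I_convergent_to S \<I> f x \<longleftrightarrow>
     (\<forall>U. eventually (\<lambda>y. y \<in> U) (nhds x) \<longrightarrow> {s \<in> S. f s \<in> U} \<in> dual_filter S \<I>)"

definition IK_convergent_to ::
    "'s set \<Rightarrow> 's set set \<Rightarrow> 's set set \<Rightarrow> ('s \<Rightarrow> 'a::topological_space) \<Rightarrow> 'a \<Rightarrow> bool" where
  "IK_convergent_to S \<I> \<K> f x \<longleftrightarrow>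
     (\<exists>M\<in>dual_filter S \<I>. I_convergent_to S \<K> (\<lambda>s. if s \<in> M then f s else x) x)"

end

theory Submission
  imports Defs
begin

text \<open>
  Let \<open>M\<close> witness that \<open>f\<close> is Cauchy along \<open>\<I>\<close> and \<open>\<K>\<close>. The subsets of \<open>M\<close> whose complement
  in \<open>M\<close> lies in \<open>\<K>\<close> form a filter, and \<open>f\<close> maps it to a Cauchy filter on \<open>X\<close>: a symmetric
  half-sized entourage has a ball, centred at some \<open>f m\<close>, that contains the values of \<open>f\<close> at almost
  all points of \<open>M\<close>, and any two points of that ball are close to each other. By completeness the
  image filter converges to some \<open>x\<close>. Since the modified function is constantly \<open>x\<close> off \<open>M\<close>, its
  exceptional sets for neighbourhoods of \<open>x\<close> are those of \<open>f\<close> on \<open>M\<close>; hence the same \<open>M\<close>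
  witnesses convergence.

  Completeness speaks of proper filters only. The image filter is improper exactly when \<open>M\<close> belongs
  to \<open>\<K>\<close>, and then every point of \<open>X\<close> is a limit.
\<close>

text \<open>The complements are taken relative to \<open>M\<close> alone, so that sets outside \<open>M\<close> are negligible;
  for \<open>M \<subseteq> S\<close> this is the dual filter of the trace of \<open>\<K>\<close> on \<open>M\<close>, seen as a filter on the whole
  type.\<close>

definition cofilter :: "'s set set \<Rightarrow> 's set \<Rightarrow> 's filter" where
  "cofilter \<K> M = Abs_filter (\<lambda>P. {s \<in> M. \<not> P s} \<in> \<K>)"

lemma eventually_cofilter:
  assumes "ideal_on S \<K>"
  shows "eventually P (cofilter \<K> M) \<longleftrightarrow> {s \<in> M. \<not> P s} \<in> \<K>"
proof -
  from assms have sub: "A \<in> \<K> \<Longrightarrow> B \<subseteq> A \<Longrightarrow> B \<in> \<K>"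
    and un: "A \<in> \<K> \<Longrightarrow> B \<in> \<K> \<Longrightarrow> A \<union> B \<in> \<K>" and ne: "\<K> \<noteq> {}" for A B
    by (auto simp: ideal_on_def)
  have "is_filter (\<lambda>P. {s \<in> M. \<not> P s} \<in> \<K>)"
  proof
    show "{s \<in> M. \<not> True} \<in> \<K>"
      using ne sub by auto
  next
    fix P Q
    assume "{s \<in> M. \<not> P s} \<in> \<K>" and "{s \<in> M. \<not> Q s} \<in> \<K>"
    from un[OF this] show "{s \<in> M. \<not> (P s \<and> Q s)} \<in> \<K>"
      by (rule sub) auto
  next
    fix P Q
    assume "\<forall>s. P s \<longrightarrow> Q s" and "{s \<in> M. \<not> P s} \<in> \<K>"
    then show "{s \<in> M. \<not> Q s} \<in> \<K>"
      by (auto elim: sub)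
  qed
  then show ?thesis
    unfolding cofilter_def by (rule eventually_Abs_filter)
qed

lemma mem_trace_ideal_imp_mem:
  assumes "ideal_on S \<K>" and "A \<in> trace_ideal \<K> M"
  shows "A \<in> \<K>"
  using assms unfolding ideal_on_def trace_ideal_def by blast

text \<open>The single centre \<open>f m\<close> suffices because a product filter contains the squares of its
  factor's members: two values close to the centre are close to each other.\<close>

lemma I_Cauchy_imp_cauchy_filter:
  fixes f :: "'s \<Rightarrow> 'a::uniform_space"
  assumes K: "ideal_on S \<K>" and C: "I_Cauchy M (trace_ideal \<K> M) f"
  shows "cauchy_filter (filtermap f (cofilter \<K> M))"
  unfolding cauchy_filter_def
proof (rule filter_leI)
  fix E :: "'a \<times> 'a \<Rightarrow> bool"
  assume "eventually E uniformity"
  then obtain D where D: "eventually D uniformity"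
    and DE: "\<And>x y z. D (x, y) \<Longrightarrow> D (y, z) \<Longrightarrow> E (x, z)"
    by (rule uniformity_transE) (rule that)
  define U where "U = {p. D p} \<inter> {p. D p}\<inverse>"
  have "U \<in> entourages"
    unfolding U_def using D by (intro entourage_symmetric_core) simp
  with C obtain m where "{n \<in> M. (f n, f m) \<notin> U} \<in> trace_ideal \<K> M"
    unfolding I_Cauchy_def by blast
  then have "{n \<in> M. (f n, f m) \<notin> U} \<in> \<K>"
    by (rule mem_trace_ideal_imp_mem[OF K])
  then have "eventually (\<lambda>y. (y, f m) \<in> U) (filtermap f (cofilter \<K> M))"
    by (simp add: eventually_filtermap eventually_cofilter[OF K])
  moreover have "E (y, z)" if "(y, f m) \<in> U" and "(z, f m) \<in> U" for y z
    using that DE by (auto simp: U_def)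
  ultimately show
    "eventually E (filtermap f (cofilter \<K> M) \<times>\<^sub>F filtermap f (cofilter \<K> M))"
    unfolding eventually_prod_same by blast
qed

lemma dual_filter_memI:
  assumes "S - A \<in> \<K>" and "A \<subseteq> S"
  shows "A \<in> dual_filter S \<K>"
  using assms unfolding dual_filter_def by (auto intro!: exI[of _ "S - A"])

lemma filtermap_cofilter_le_nhds_imp_I_convergent:
  assumes K: "ideal_on S \<K>" and "M \<subseteq> S"
    and le: "filtermap f (cofilter \<K> M) \<le> nhds x"
  shows "I_convergent_to S \<K> (\<lambda>s. if s \<in> M then f s else x) x"
  unfolding I_convergent_to_def
proof (intro allI impI)
  fix U
  assume U: "eventually (\<lambda>y. y \<in> U) (nhds x)"
  then have "x \<in> U"
    by (rule eventually_nhds_x_imp_x)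
  then have "S - {s \<in> S. (if s \<in> M then f s else x) \<in> U} = {s \<in> M. f s \<notin> U}"
    using \<open>M \<subseteq> S\<close> by auto
  also have "\<dots> \<in> \<K>"
    using filter_leD[OF le U] by (simp add: eventually_filtermap eventually_cofilter[OF K])
  finally show "{s \<in> S. (if s \<in> M then f s else x) \<in> U} \<in> dual_filter S \<K>"
    by (rule dual_filter_memI) auto
qed

theorem corollary4p2:
  fixes S :: "'s set"
    and \<I> \<K> :: "'s set set"
    and f :: "'s \<Rightarrow> 'a::{uniform_space, t2_space}"
  assumes "ideal_on S \<I>" and "ideal_on S \<K>"
    and "complete (UNIV :: 'a set)"
    and "IK_Cauchy S \<I> \<K> f"
  shows "\<exists>x. IK_convergent_to S \<I> \<K> f x"
proof -
  from assms(4) obtain M where M: "M \<in> dual_filter S \<I>"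
    and C: "I_Cauchy M (trace_ideal \<K> M) f"
    unfolding IK_Cauchy_def by blast
  from M have "M \<subseteq> S"
    by (auto simp: dual_filter_def)
  let ?G = "filtermap f (cofilter \<K> M)"
  have "\<exists>x. ?G \<le> nhds x"
  proof (cases "?G = bot")
    case True
    then show ?thesis by simp
  next
    case False
    with I_Cauchy_imp_cauchy_filter[OF assms(2) C] assms(3) show ?thesis
      unfolding complete_uniform by auto
  qed
  then obtain x where "?G \<le> nhds x" ..
  with assms(2) \<open>M \<subseteq> S\<close> have "I_convergent_to S \<K> (\<lambda>s. if s \<in> M then f s else x) x"
    by (rule filtermap_cofilter_le_nhds_imp_I_convergent)
  with M show ?thesis
    unfolding IK_convergent_to_def by blast
qed

end
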